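(* Let $u\colon \mathbb{C}\to\mathbb{R}$ be a solution of $\Delta u+e^{2u}=0$ in the plane, and let $f$ be a developing map of $u$, i.e. a meromorphic function $f$ in $\mathbb{C}$ that is a local homeomorphism into $\overline{\mathbb{C}}$ with $$u=\log\frac{2|f'|}{1+|f|^2}.$$ If $u$ is concave, then there exist a linear-fractional transformation $L$ and constants $a,b\in\mathbb{C}$ with $a\neq 0$ such that $$f(z)=L(e^{az+b})\quad\text{for all } z\in\mathbb{C}.$$
   Context: $\overline{\mathbb{C}}=\mathbb{C}\cup\{\infty\}$ is the Riemann sphere. By Liouville, every solution $u$ of $\Delta u+e^{2u}=0$ in the plane has the form $u=\log\frac{2|f'|}{1+|f|^2}$ for some meromorphic local homeomorphism $f\colon\mathbb{C}\to\overline{\mathbb{C}}$, that is, a meromorphic function with only simple poles and with $f'(z)\neq0$ at all points that are not poles; at the poles of $f$ the expression is understood by continuous extension. Such an $f$ is called a developing map. Concavity of $u$ means concavity as a real-valued function on $\mathbb{C}\cong\mathbb{R}^2$. A linear-fractional transformation is an (invertible) Möbius transformation $L(w)=(\alpha w+\beta)/(\gamma w+\delta)$, $\alpha\delta-\beta\gamma\ne0$. *)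

theory Defs
  imports "HOL-Complex_Analysis.Complex_Analysis"
begin

text \<open>Partial derivative of a real-valued function on the plane in direction \<open>v\<close>; the directions
  \<open>1\<close> and \<open>\<i>\<close> are the \<open>x\<close>- and \<open>y\<close>-directions.\<close>

definition partial :: "complex \<Rightarrow> (complex \<Rightarrow> real) \<Rightarrow> complex \<Rightarrow> real" where
  "partial v u z = deriv (\<lambda>t::real. u (z + of_real t * v)) 0"

definition has_partial :: "complex \<Rightarrow> (complex \<Rightarrow> real) \<Rightarrow> bool" where
  "has_partial v u \<longleftrightarrow> (\<forall>z. (\<lambda>t::real. u (z + of_real t * v)) differentiable (at 0))"

definition C1 :: "(complex \<Rightarrow> real) \<Rightarrow> bool" where
  "C1 u \<longleftrightarrow> (\<forall>v\<in>{1, \<i>}. has_partial v u \<and> continuous_on UNIV (partial v u))"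

definition C2 :: "(complex \<Rightarrow> real) \<Rightarrow> bool" where
  "C2 u \<longleftrightarrow> C1 u \<and> (\<forall>v\<in>{1, \<i>}. C1 (partial v u))"

definition laplacian :: "(complex \<Rightarrow> real) \<Rightarrow> complex \<Rightarrow> real" where
  "laplacian u z = partial 1 (partial 1 u) z + partial \<i> (partial \<i> u) z"

definition liouville_solution :: "(complex \<Rightarrow> real) \<Rightarrow> bool" where
  "liouville_solution u \<longleftrightarrow> C2 u \<and> (\<forall>z. laplacian u z + exp (2 * u z) = 0)"

text \<open>The Riemann sphere, with \<open>None\<close> as the point at infinity.\<close>

type_synonym riemann_sphere = "complex option"

text \<open>Meromorphic functions in the library are complex-valued, and a nicely meromorphic function
  has the dummy value \<open>0\<close> at its poles. The associated map to the sphere is the following.\<close>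

definition sphere_map :: "(complex \<Rightarrow> complex) \<Rightarrow> complex \<Rightarrow> riemann_sphere" where
  "sphere_map f z = (if is_pole f z then None else Some (f z))"

definition meromorphic_local_homeo :: "(complex \<Rightarrow> complex) \<Rightarrow> bool" where
  "meromorphic_local_homeo f \<longleftrightarrow>
     f nicely_meromorphic_on UNIV \<and>
     (\<forall>z. is_pole f z \<longrightarrow> zorder f z = -1) \<and>
     (\<forall>z. \<not> is_pole f z \<longrightarrow> deriv f z \<noteq> 0)"

definition log_spherical_deriv :: "(complex \<Rightarrow> complex) \<Rightarrow> complex \<Rightarrow> real" where
  "log_spherical_deriv f z = ln (2 * cmod (deriv f z) / (1 + (cmod (f z))\<^sup>2))"

text \<open>At a pole the values of \<open>f\<close> and \<open>deriv f\<close> carry no information; there the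
  formula for \<open>u\<close> is extended by continuity.\<close>

definition developing_map :: "(complex \<Rightarrow> complex) \<Rightarrow> (complex \<Rightarrow> real) \<Rightarrow> bool" where
  "developing_map f u \<longleftrightarrow>
     meromorphic_local_homeo f \<and>
     (\<forall>z. \<not> is_pole f z \<longrightarrow> u z = log_spherical_deriv f z) \<and>
     (\<forall>z. is_pole f z \<longrightarrow> (log_spherical_deriv f \<longlongrightarrow> u z) (at z))"

definition moebius ::
    "complex \<Rightarrow> complex \<Rightarrow> complex \<Rightarrow> complex \<Rightarrow> riemann_sphere \<Rightarrow> riemann_sphere" where
  "moebius \<alpha> \<beta> \<gamma> \<delta> p =
     (case p of
        Some w \<Rightarrow> if \<gamma> * w + \<delta> = 0 then None else Some ((\<alpha> * w + \<beta>) / (\<gamma> * w + \<delta>))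
      | None \<Rightarrow> if \<gamma> = 0 then None else Some (\<alpha> / \<gamma>))"

definition linear_fractional :: "(riemann_sphere \<Rightarrow> riemann_sphere) \<Rightarrow> bool" where
  "linear_fractional L \<longleftrightarrow>
     (\<exists>\<alpha> \<beta> \<gamma> \<delta>. \<alpha> * \<delta> - \<beta> * \<gamma> \<noteq> 0 \<and> L = moebius \<alpha> \<beta> \<gamma> \<delta>)"

end

theory Submission
  imports Defs
begin

text \<open>Write \<open>W = 2 \<partial>u\<close> and \<open>Q = \<partial>\<partial>u - (\<partial>u)\<^sup>2\<close>; where \<open>f\<close> is finite, \<open>2 Q\<close> is the Schwarzian
  derivative of \<open>f\<close>. Near a pole \<open>1 / f\<close> represents the same \<open>u\<close>, so \<open>Q\<close> is entire.
  Concavity bounds the Hessian of \<open>u\<close> by its trace \<open>e\<^bsup>2u\<^esup>\<close> up to sign, and forces \<open>u\<close> to be bounded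
  above. Hence \<open>W\<close> grows linearly and \<open>Q\<close> is a polynomial. On a ray along which \<open>u\<close> decreases,
  \<open>e\<^bsup>2u\<^esup>\<close> decays exponentially, so \<open>Q\<close> is bounded on it and thus constant, and it is nonzero because
  the gradient does not tend to \<open>0\<close> there. Functions with constant nonzero Schwarzian
  derivative are linear-fractional in an exponential.\<close>

section \<open>Calculus of the spherical derivative\<close>

definition pre_schwarzian :: "(complex \<Rightarrow> complex) \<Rightarrow> complex \<Rightarrow> complex" where
  "pre_schwarzian F z = deriv (deriv F) z / deriv F z"

definition half_schwarzian :: "(complex \<Rightarrow> complex) \<Rightarrow> complex \<Rightarrow> complex" where
  "half_schwarzian F z = deriv (pre_schwarzian F) z / 2 - (pre_schwarzian F z)\<^sup>2 / 4"

text \<open>This is twice the derivative in \<open>z\<close>, in the Wirtinger sense, of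
  \<open>log_spherical_deriv F\<close>.\<close>

definition log_spherical_grad :: "(complex \<Rightarrow> complex) \<Rightarrow> complex \<Rightarrow> complex" where
  "log_spherical_grad F z =
     pre_schwarzian F z - 2 * deriv F z * cnj (F z) / (1 + F z * cnj (F z))"

text \<open>Locally \<open>ln (cmod (G z))\<close> is the real part of a branch of the logarithm of
  \<open>G\<close>, hence the logarithmic derivative. Differentiating the norm directly avoids
  choosing a branch.\<close>

lemma has_derivative_ln_cmod:
  assumes G: "(G has_field_derivative G') (at z)" and nz: "G z \<noteq> 0"
  shows "((\<lambda>z. ln (cmod (G z))) has_derivative (\<lambda>h. Re (G' / G z * h))) (at z)"
proof -
  have "((\<lambda>z. cmod (G z)) has_derivative (\<lambda>h. (G' * h) \<bullet> sgn (G z))) (at z)"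
    using has_derivative_compose[OF G[unfolded has_field_derivative_def] has_derivative_norm[OF nz]]
    by simp
  then have "((\<lambda>z. ln (cmod (G z))) has_derivative (\<lambda>h. ((G' * h) \<bullet> sgn (G z)) / cmod (G z))) (at z)"
    using nz by (auto intro!: derivative_eq_intros simp: field_simps)
  moreover have "((G' * h) \<bullet> sgn (G z)) / cmod (G z) = Re (G' / G z * h)" for h
  proof -
    have "((G' * h) \<bullet> sgn (G z)) / cmod (G z) = Re (G' * h * cnj (G z)) / (cmod (G z))\<^sup>2"
      by (simp add: sgn_div_norm inner_complex_def power2_eq_square add_divide_distrib divide_inverse algebra_simps)
    also have "\<dots> = Re (G' * h * cnj (G z) / (of_real ((cmod (G z))\<^sup>2)))"
      by (simp only: Re_divide_of_real)
    also have "G' * h * cnj (G z) / (of_real ((cmod (G z))\<^sup>2)) = G' / G z * h"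
      using nz by (simp only: complex_norm_square) (simp add: field_simps)
    finally show ?thesis .
  qed
  ultimately show ?thesis by simp
qed

lemma one_plus_mult_cnj: "1 + w * cnj w = of_real (1 + (cmod w)\<^sup>2)"
  by (simp add: complex_norm_square del: of_real_power)

lemma one_plus_norm_sq_neq0: "1 + (cmod w)\<^sup>2 \<noteq> 0"
  by (smt (verit) zero_le_power2)

lemma one_plus_mult_cnj_neq0: "1 + w * cnj w \<noteq> 0"
  using one_plus_norm_sq_neq0[of w] by (simp only: one_plus_mult_cnj of_real_eq_0_iff)  simp

lemma has_derivative_log_spherical_deriv:
  assumes F: "F holomorphic_on S" "open S" "z \<in> S" and nz: "deriv F z \<noteq> 0"
  shows "(log_spherical_deriv F has_derivative (\<lambda>h. Re (log_spherical_grad F z * h))) (at z)"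
proof -
  have d1: "(F has_field_derivative deriv F z) (at z)"
    using F holomorphic_derivI by blast
  have d2: "(deriv F has_field_derivative deriv (deriv F) z) (at z)"
    using F holomorphic_derivI holomorphic_deriv by blast
  have N: "((\<lambda>z. (cmod (F z))\<^sup>2) has_derivative (\<lambda>h. 2 * Re (deriv F z * cnj (F z) * h))) (at z)"
  proof -
    have "((\<lambda>z. F z \<bullet> F z) has_derivative (\<lambda>h. F z \<bullet> (deriv F z * h) + (deriv F z * h) \<bullet> F z)) (at z)"
      using d1[unfolded has_field_derivative_def] by (intro has_derivative_inner)
    then show ?thesis
      by (simp add: dot_square_norm) (simp add: inner_complex_def algebra_simps)
  qed
  have L: "((\<lambda>z. ln (1 + (cmod (F z))\<^sup>2)) has_derivative
      (\<lambda>h. 2 * Re (deriv F z * cnj (F z) * h) / (1 + (cmod (F z))\<^sup>2))) (at z)"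
    using has_derivative_ln[OF _ has_derivative_add[OF has_derivative_const[of 1] N]]
    by (simp add: add_pos_nonneg divide_inverse)
  \<comment> \<open>The logarithm is split into three terms, which is justified where
    \<open>deriv F\<close> is nonzero; the derivative at \<open>z\<close> needs this on a whole
    neighbourhood.\<close>
  have open_nz: "eventually (\<lambda>w. deriv F w \<noteq> 0) (nhds z)"
  proof -
    have "(deriv F \<longlongrightarrow> deriv F z) (at z)"
      using d2 DERIV_isCont isContD by blast
    then show ?thesis
      using nz by (auto simp: eventually_nhds_conv_at dest: tendsto_imp_eventually_ne)
  qed
  have "((\<lambda>z. ln 2 + ln (cmod (deriv F z)) - ln (1 + (cmod (F z))\<^sup>2)) has_derivative
     (\<lambda>h. Re (deriv (deriv F) z / deriv F z * h)
        - 2 * Re (deriv F z * cnj (F z) * h) / (1 + (cmod (F z))\<^sup>2))) (at z)"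
    by (rule derivative_eq_intros has_derivative_ln_cmod[OF d2 nz] L refl)+ simp
  moreover have "Re (deriv (deriv F) z / deriv F z * h)
        - 2 * Re (deriv F z * cnj (F z) * h) / (1 + (cmod (F z))\<^sup>2)
      = Re (log_spherical_grad F z * h)" for h
  proof -
    have "2 * Re (deriv F z * cnj (F z) * h) / (1 + (cmod (F z))\<^sup>2)
      = Re (2 * (deriv F z * cnj (F z) * h) / of_real (1 + (cmod (F z))\<^sup>2))"
      by (simp only: Re_divide_of_real) simp
    then show ?thesis
      unfolding log_spherical_grad_def pre_schwarzian_def one_plus_mult_cnj
      by (simp add: left_diff_distrib algebra_simps del: of_real_add of_real_power)
  qed
  ultimately have "((\<lambda>z. ln 2 + ln (cmod (deriv F z)) - ln (1 + (cmod (F z))\<^sup>2)) has_derivative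
     (\<lambda>h. Re (log_spherical_grad F z * h))) (at z)" by simp
  then show ?thesis
  proof (rule has_derivative_transform_eventually)
    have "eventually (\<lambda>w. ln 2 + ln (cmod (deriv F w)) - ln (1 + (cmod (F w))\<^sup>2) = log_spherical_deriv F w) (nhds z)"
      using open_nz by eventually_elim
        (simp add: log_spherical_deriv_def ln_mult ln_div add_pos_nonneg one_plus_norm_sq_neq0)
    then show "eventually (\<lambda>w. ln 2 + ln (cmod (deriv F w)) - ln (1 + (cmod (F w))\<^sup>2) = log_spherical_deriv F w) (at z)"
      and "ln 2 + ln (cmod (deriv F z)) - ln (1 + (cmod (F z))\<^sup>2) = log_spherical_deriv F z"
      by (auto simp: eventually_nhds_conv_at)
  qed auto
qed

lemma holomorphic_pre_schwarzian:
  assumes F: "F holomorphic_on S" "open S" and nz: "\<And>z. z \<in> S \<Longrightarrow> deriv F z \<noteq> 0"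
  shows "pre_schwarzian F holomorphic_on S"
  unfolding pre_schwarzian_def using assms by (intro holomorphic_intros holomorphic_deriv) auto

lemma holomorphic_half_schwarzian:
  assumes F: "F holomorphic_on S" "open S" and nz: "\<And>z. z \<in> S \<Longrightarrow> deriv F z \<noteq> 0"
  shows "half_schwarzian F holomorphic_on S"
  unfolding half_schwarzian_def using assms
  by (intro holomorphic_intros holomorphic_deriv holomorphic_pre_schwarzian) auto

lemma exp_log_spherical_deriv:
  assumes "deriv F z \<noteq> 0"
  shows "complex_of_real (exp (2 * log_spherical_deriv F z)) =
    4 * (deriv F z * cnj (deriv F z)) / (1 + F z * cnj (F z))\<^sup>2"
proof -
  have "0 < 2 * cmod (deriv F z) / (1 + (cmod (F z))\<^sup>2)"
    using assms by (intro divide_pos_pos) (auto simp: add_pos_nonneg)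
  then have "exp (2 * log_spherical_deriv F z) = (2 * cmod (deriv F z) / (1 + (cmod (F z))\<^sup>2))\<^sup>2"
    unfolding log_spherical_deriv_def exp_double by simp
  then show ?thesis
    unfolding one_plus_mult_cnj complex_norm_square[symmetric]
    by (simp add: power_divide power_mult_distrib)
qed

text \<open>The coefficients of \<open>h\<close> and \<open>cnj h\<close> are the two Wirtinger
  derivatives of the gradient. The first expresses the Schwarzian derivative through
  \<open>u\<close>; the second is Liouville's equation for
  \<open>log_spherical_deriv F\<close>.\<close>

lemma has_derivative_log_spherical_grad:
  assumes F: "F holomorphic_on S" "open S" "z \<in> S" and nz: "\<And>z. z \<in> S \<Longrightarrow> deriv F z \<noteq> 0"
  shows "(log_spherical_grad F has_derivative
    (\<lambda>h. (2 * half_schwarzian F z + (log_spherical_grad F z)\<^sup>2 / 2) * h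
       - of_real (exp (2 * log_spherical_deriv F z) / 2) * cnj h)) (at z)"
proof -
  define D where "D = 1 + F z * cnj (F z)"
  have D: "D \<noteq> 0" "1 + F z * cnj (F z) \<noteq> 0" unfolding D_def by (rule one_plus_mult_cnj_neq0)+
  have d1: "(F has_derivative (*) (deriv F z)) (at z)"
    using F holomorphic_derivI has_field_derivative_def by metis
  have d2: "(deriv F has_derivative (*) (deriv (deriv F) z)) (at z)"
    using F holomorphic_derivI holomorphic_deriv has_field_derivative_def by metis
  have d3: "(pre_schwarzian F has_derivative (*) (deriv (pre_schwarzian F) z)) (at z)"
    using F holomorphic_derivI[OF holomorphic_pre_schwarzian[OF F(1,2) nz]] has_field_derivative_def by metis
  have "(log_spherical_grad F has_derivative
    (\<lambda>h. deriv (pre_schwarzian F) z * h -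
      2 * ((deriv (deriv F) z * h * cnj (F z) + deriv F z * cnj (deriv F z * h)) / D
          - deriv F z * cnj (F z) * (F z * cnj (deriv F z * h) + deriv F z * h * cnj (F z)) / D\<^sup>2))) (at z)"
    unfolding log_spherical_grad_def
    by (rule derivative_eq_intros d1 d2 d3 refl D)+
      (use D in \<open>simp add: D_def[symmetric] field_simps power2_eq_square\<close>)
  moreover have "deriv (pre_schwarzian F) z * h -
      2 * ((deriv (deriv F) z * h * cnj (F z) + deriv F z * cnj (deriv F z * h)) / D
          - deriv F z * cnj (F z) * (F z * cnj (deriv F z * h) + deriv F z * h * cnj (F z)) / D\<^sup>2)
     = (2 * half_schwarzian F z + (log_spherical_grad F z)\<^sup>2 / 2) * h
       - of_real (exp (2 * log_spherical_deriv F z) / 2) * cnj h" for h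
  proof -
    define p a b c cb q where "p = pre_schwarzian F z" and "a = F z" and "b = cnj (F z)"
      and "c = deriv F z" and "cb = cnj (deriv F z)" and "q = deriv (pre_schwarzian F) z"
    have e: "deriv (deriv F) z = p * c"
      using nz[OF F(3)] unfolding p_def c_def pre_schwarzian_def by simp
    have D': "D = 1 + a * b" "1 + a * b \<noteq> 0" using D unfolding D_def a_def b_def by auto
    have hs: "half_schwarzian F z = q / 2 - p\<^sup>2 / 4" "log_spherical_grad F z = p - 2 * c * b / D"
      unfolding half_schwarzian_def log_spherical_grad_def p_def q_def c_def b_def D_def by auto
    have ex: "of_real (exp (2 * log_spherical_deriv F z) / 2) = 2 * (c * cb) / D\<^sup>2"
      using exp_log_spherical_deriv[OF nz[OF F(3)]] unfolding c_def cb_def D_def by simp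
    have "q * h - 2 * ((p * c * h * b + c * (cb * cnj h)) / D - c * b * (a * (cb * cnj h) + c * h * b) / D\<^sup>2)
      = (2 * (q / 2 - p\<^sup>2 / 4) + (p - 2 * c * b / D)\<^sup>2 / 2) * h - 2 * (c * cb) / D\<^sup>2 * cnj h"
    proof -
      \<comment> \<open>The terms in \<open>cnj h\<close> collapse because
        \<open>D - a * b = 1\<close>; those in \<open>h\<close> complete the square of the
        gradient.\<close>
      have "D * (c * cb * cnj h) - c * b * (a * (cb * cnj h)) = c * cb * cnj h"
        unfolding D' by (simp add: algebra_simps)
      then have "(c * cb * cnj h) / D - c * b * (a * (cb * cnj h)) / D\<^sup>2 = c * cb / D\<^sup>2 * cnj h"
        using D by (simp add: field_simps power2_eq_square)
      moreover have "q * h - 2 * (p * c * h * b / D - c * b * (c * h * b) / D\<^sup>2)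
         = (2 * (q / 2 - p\<^sup>2 / 4) + (p - 2 * c * b / D)\<^sup>2 / 2) * h"
        using D by (simp add: field_simps power2_eq_square)
      ultimately show ?thesis
        by (simp add: add_divide_distrib diff_divide_distrib distrib_left algebra_simps)
    qed
    then show ?thesis
      unfolding hs ex e complex_cnj_mult a_def b_def c_def cb_def q_def .
  qed
  ultimately show ?thesis by simp
qed

section \<open>Holomorphic representatives of \<open>u\<close> and its global derivatives\<close>

lemma developing_map_local_nonpole:
  assumes dev: "developing_map f u" and z: "\<not> is_pole f z"
  obtains r where "r > 0" "f holomorphic_on ball z r"
    "\<And>w. w \<in> ball z r \<Longrightarrow> \<not> is_pole f w \<and> deriv f w \<noteq> 0 \<and> u w = log_spherical_deriv f w"
proof -
  have "f analytic_on {z}"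
    using dev z by (auto simp: developing_map_def meromorphic_local_homeo_def
        intro: nicely_meromorphic_on_imp_analytic_at)
  then obtain r where r: "r > 0" "f holomorphic_on ball z r"
    by (auto simp: analytic_at_ball)
  have "\<not> is_pole f w" if "w \<in> ball z r" for w
    using r(2) that not_is_pole_holomorphic open_ball by blast
  then show ?thesis
    using dev r that by (auto simp: developing_map_def meromorphic_local_homeo_def)
qed

text \<open>Inversion is a rotation of the sphere, so it preserves the spherical derivative.\<close>

lemma log_spherical_deriv_inverse:
  assumes F: "F holomorphic_on S" "open S" "w \<in> S"
    and eq: "\<And>x. x \<in> S \<Longrightarrow> f x = inverse (F x)" and nz: "F w \<noteq> 0"
  shows "log_spherical_deriv f w = log_spherical_deriv F w"
    and "deriv f w = - deriv F w / (F w)\<^sup>2"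
proof -
  have "((\<lambda>x. inverse (F x)) has_field_derivative - deriv F w / (F w)\<^sup>2) (at w)"
    using holomorphic_derivI[OF F] nz
    by (auto intro!: derivative_eq_intros simp: field_simps power2_eq_square)
  then have "(f has_field_derivative - deriv F w / (F w)\<^sup>2) (at w)"
    by (rule has_field_derivative_transform_within_open[OF _ F(2,3)]) (use eq in auto)
  then show d: "deriv f w = - deriv F w / (F w)\<^sup>2"
    by (rule DERIV_imp_deriv)
  have "2 * (cmod (deriv F w) / (cmod (F w))\<^sup>2) / (1 + (inverse (cmod (F w)))\<^sup>2)
      = 2 * cmod (deriv F w) / (1 + (cmod (F w))\<^sup>2)"
  proof -
    have "(cmod (F w))\<^sup>2 * (1 + (inverse (cmod (F w)))\<^sup>2) = 1 + (cmod (F w))\<^sup>2"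
      using nz by (simp add: power_inverse distrib_left)
    then show ?thesis by (metis divide_divide_eq_left times_divide_eq_right)
  qed
  moreover have "cmod (- deriv F w / (F w)\<^sup>2) = cmod (deriv F w) / (cmod (F w))\<^sup>2"
    by (simp add: norm_divide norm_power)
  ultimately show "log_spherical_deriv f w = log_spherical_deriv F w"
    unfolding log_spherical_deriv_def d eq[OF F(3)] norm_inverse by (simp only:)
qed

text \<open>The representative is \<open>1 / f\<close> with its removable singularity filled in. The
  pole is simple, so \<open>f w = g w / (w - z)\<close> with \<open>g z\<close> nonzero, and
  \<open>F\<close> has the nonzero derivative \<open>1 / g z\<close> at \<open>z\<close>.\<close>

lemma developing_map_local_pole:
  assumes dev: "developing_map f u" and z: "is_pole f z"
  obtains r F where "r > 0" "F holomorphic_on ball z r"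
    "\<And>w. w \<in> ball z r \<Longrightarrow> deriv F w \<noteq> 0 \<and> u w = log_spherical_deriv F w"
proof -
  have nm: "f nicely_meromorphic_on UNIV" and zo: "zorder f z = -1"
    using dev z by (auto simp: developing_map_def meromorphic_local_homeo_def)
  have "isolated_singularity_at f z"
    using nm by (meson UNIV_I meromorphic_on_isolated_singularity meromorphic_on_meromorphic_at
        meromorphic_on_subset nicely_meromorphic_on_def subset_UNIV)
  then obtain s where s: "s > 0" "f analytic_on ball z s - {z}"
    unfolding isolated_singularity_at_def by blast
  then have hol: "f holomorphic_on ball z s - {z}" by (simp add: analytic_imp_holomorphic)
  obtain g r where g: "g z \<noteq> 0" "r > 0" "cball z r \<subseteq> ball z s" "g holomorphic_on cball z r"
    "\<And>w. w \<in> cball z r - {z} \<Longrightarrow> f w = g w / (w - z) \<and> g w \<noteq> 0"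
    using zorder_exist_pole[OF hol open_ball _ z] s zo by auto
  have gnz: "g w \<noteq> 0" if "w \<in> ball z r" for w
    using g(1) g(5)[of w] that by (cases "w = z") auto
  define F where "F = (\<lambda>w. (w - z) / g w)"
  have holF: "F holomorphic_on ball z r" unfolding F_def
    using gnz holomorphic_on_subset[OF g(4) ball_subset_cball]
    by (intro holomorphic_intros) auto
  have off: "deriv F w \<noteq> 0 \<and> u w = log_spherical_deriv F w \<and> log_spherical_deriv f w = log_spherical_deriv F w"
    if w: "w \<in> ball z r - {z}" for w
  proof -
    have op: "open (ball z r - {z})" by auto
    have hf: "f holomorphic_on ball z r - {z}"
      by (rule holomorphic_on_subset[OF hol]) (use g(3) in auto)
    have eq: "F x = inverse (f x)" if "x \<in> ball z r - {z}" for x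
      using g(5)[of x] that by (auto simp: F_def)
    have fw: "f w \<noteq> 0" using g(5)[of w] w by auto
    have np: "\<not> is_pole f w" using hf op w not_is_pole_holomorphic by blast
    show ?thesis
      using log_spherical_deriv_inverse[OF hf op w eq fw] np fw dev
      by (auto simp: developing_map_def meromorphic_local_homeo_def)
  qed
  have dz: "deriv F z = 1 / g z"
  proof -
    have gd: "(g has_field_derivative deriv g z) (at z)"
      using holomorphic_derivI[OF holomorphic_on_subset[OF g(4) ball_subset_cball] open_ball] g(2) by simp
    have "(F has_field_derivative 1 / g z) (at z)"
      unfolding F_def by (rule derivative_eq_intros gd refl g(1))+ (use g(1) in \<open>simp add: field_simps power2_eq_square\<close>)
    then show ?thesis by (rule DERIV_imp_deriv)
  qed
  \<comment> \<open>At the pole itself \<open>u\<close> is prescribed only as a limit, so the two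
    values are identified by uniqueness of limits.\<close>
  have "u z = log_spherical_deriv F z"
  proof (rule tendsto_unique[of "at z" "log_spherical_deriv f"])
    show "(log_spherical_deriv f \<longlongrightarrow> u z) (at z)"
      using dev z by (auto simp: developing_map_def)
    have "(log_spherical_deriv F has_derivative (\<lambda>h. Re (log_spherical_grad F z * h))) (at z)"
      by (rule has_derivative_log_spherical_deriv[OF holF]) (use dz g(1,2) in auto)
    then have "(log_spherical_deriv F \<longlongrightarrow> log_spherical_deriv F z) (at z)"
      using has_derivative_continuous isContD by blast
    then show "(log_spherical_deriv f \<longlongrightarrow> log_spherical_deriv F z) (at z)"
    proof (rule Lim_transform_eventually)
      have "eventually (\<lambda>w. w \<in> ball z r - {z}) (at z)"
        using g(2) by (intro eventually_at_in_open) auto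
      then show "eventually (\<lambda>w. log_spherical_deriv F w = log_spherical_deriv f w) (at z)"
        by eventually_elim (use off in auto)
    qed
  qed auto
  then have "deriv F w \<noteq> 0 \<and> u w = log_spherical_deriv F w" if "w \<in> ball z r" for w
    using off[of w] that dz g(1) by (cases "w = z") auto
  then show ?thesis using that g(2) holF by blast
qed

text \<open>The minus sign is due to \<open>Re (w * \<i>) = - Im w\<close>. Reading the gradient off
  \<open>u\<close> alone makes it independent of the local representative.\<close>

definition complex_grad :: "(complex \<Rightarrow> real) \<Rightarrow> complex \<Rightarrow> complex" where
  "complex_grad u z =
     Complex (frechet_derivative u (at z) 1) (- frechet_derivative u (at z) \<i>)"

lemma complex_grad_eq:
  assumes "(u has_derivative (\<lambda>h. Re (w * h))) (at z)"
  shows "complex_grad u z = w"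
  unfolding complex_grad_def frechet_derivative_at[OF assms, symmetric]
  by (simp add: complex_eq_iff)

text \<open>\<open>W\<close> and \<open>A\<close> are built from \<open>u\<close> alone, so the
  local formulas for the representatives \<open>f\<close> and \<open>1 / f\<close> fit together
  globally. Near each point \<open>A / 2 - W^2 / 4\<close> is the \<open>half_schwarzian\<close> of
  a holomorphic representative, hence holomorphic there.\<close>

lemma developing_map_derivatives:
  assumes dev: "developing_map f u"
  obtains W A where
    "\<And>z. (u has_derivative (\<lambda>h. Re (W z * h))) (at z)"
    "\<And>z. (W has_derivative (\<lambda>h. A z * h - of_real (exp (2 * u z) / 2) * cnj h)) (at z)"
    "(\<lambda>z. A z / 2 - (W z)\<^sup>2 / 4) holomorphic_on UNIV"
    "\<And>z. \<not> is_pole f z \<Longrightarrow> A z / 2 - (W z)\<^sup>2 / 4 = half_schwarzian f z"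
proof -
  define W where "W = complex_grad u"
  \<comment> \<open>Solved from the value of the derivative of \<open>W\<close> in direction
    \<open>h = 1\<close>.\<close>
  define A where "A = (\<lambda>z. frechet_derivative W (at z) 1 + of_real (exp (2 * u z) / 2))"
  have loc: "(u has_derivative (\<lambda>h. Re (W z * h))) (at z)
      \<and> (W has_derivative (\<lambda>h. A z * h - of_real (exp (2 * u z) / 2) * cnj h)) (at z)
      \<and> A z / 2 - (W z)\<^sup>2 / 4 = half_schwarzian F z"
    if F: "F holomorphic_on S" "open S" "z \<in> S"
      and nz: "\<And>w. w \<in> S \<Longrightarrow> deriv F w \<noteq> 0" and u: "\<And>w. w \<in> S \<Longrightarrow> u w = log_spherical_deriv F w"
    for F S z
  proof -
    have du: "(u has_derivative (\<lambda>h. Re (log_spherical_grad F w * h))) (at w)" if "w \<in> S" for w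
      by (rule has_derivative_transform_within_open
          [OF has_derivative_log_spherical_deriv[OF F(1,2) that nz[OF that]] F(2) that])
        (use u in auto)
    have W: "W w = log_spherical_grad F w" if "w \<in> S" for w
      unfolding W_def using du[OF that] by (rule complex_grad_eq)
    have dW: "(W has_derivative
      (\<lambda>h. (2 * half_schwarzian F z + (log_spherical_grad F z)\<^sup>2 / 2) * h
         - of_real (exp (2 * u z) / 2) * cnj h)) (at z)"
      unfolding u[OF F(3)]
      by (rule has_derivative_transform_within_open
          [OF has_derivative_log_spherical_grad[OF F nz] F(2,3)])
        (use W in auto)
    have "A z = 2 * half_schwarzian F z + (W z)\<^sup>2 / 2"
      unfolding A_def frechet_derivative_at[OF dW, symmetric] using W[OF F(3)] by simp
    then show ?thesis using du[OF F(3)] dW W[OF F(3)] by (simp add: add_divide_distrib)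
  qed
  have ex: "\<exists>r>0. \<exists>F. F holomorphic_on ball z r \<and> (\<forall>w\<in>ball z r. deriv F w \<noteq> 0 \<and> u w = log_spherical_deriv F w)" for z
    using developing_map_local_pole[OF dev, of z] developing_map_local_nonpole[OF dev, of z] by metis
  show ?thesis
  proof
    show "(u has_derivative (\<lambda>h. Re (W z * h))) (at z)"
      and "(W has_derivative (\<lambda>h. A z * h - of_real (exp (2 * u z) / 2) * cnj h)) (at z)" for z
      using ex[of z] loc[of _ "ball z _" z] by (meson centre_in_ball open_ball)+
    show "(\<lambda>z. A z / 2 - (W z)\<^sup>2 / 4) holomorphic_on UNIV"
    proof -
      have "(\<lambda>z. A z / 2 - (W z)\<^sup>2 / 4) field_differentiable (at z)" for z
      proof -
        obtain r F where r: "r > 0" "F holomorphic_on ball z r"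
          "\<And>w. w \<in> ball z r \<Longrightarrow> deriv F w \<noteq> 0" "\<And>w. w \<in> ball z r \<Longrightarrow> u w = log_spherical_deriv F w"
          using ex[of z] by metis
        have "half_schwarzian F holomorphic_on ball z r"
          using r by (intro holomorphic_half_schwarzian) auto
        then have "(\<lambda>z. A z / 2 - (W z)\<^sup>2 / 4) holomorphic_on ball z r"
          by (rule holomorphic_transform) (use loc[OF r(2) open_ball _ r(3,4)] in auto)
        then show ?thesis using r(1) holomorphic_on_imp_differentiable_at by (metis centre_in_ball open_ball)
      qed
      then show ?thesis by (simp add: holomorphic_on_def field_differentiable_at_within)
    qed
    show "A z / 2 - (W z)\<^sup>2 / 4 = half_schwarzian f z" if np: "\<not> is_pole f z" for z
    proof -
      obtain r where "r > 0" "f holomorphic_on ball z r"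
        "\<And>w. w \<in> ball z r \<Longrightarrow> \<not> is_pole f w \<and> deriv f w \<noteq> 0 \<and> u w = log_spherical_deriv f w"
        using developing_map_local_nonpole[OF dev np] by metis
      then show ?thesis using loc[of f "ball z r" z] by auto
    qed
  qed
qed

section \<open>Concavity and second derivatives\<close>

text \<open>If \<open>d < 0\<close>, then \<open>\<phi> t + \<phi> (- t)\<close> has negative
  derivative just to the right of \<open>0\<close> and drops below \<open>2 * \<phi> 0\<close>. The
  local form serves both concavity and interior minima.\<close>

lemma midpoint_convex_imp_second_derivative_nonneg:
  fixes \<phi> \<phi>' :: "real \<Rightarrow> real"
  assumes d1: "\<And>t. (\<phi> has_real_derivative \<phi>' t) (at t)"
    and d2: "(\<phi>' has_real_derivative d) (at 0)"
    and e: "e > 0" and ge: "\<And>t. 0 < t \<Longrightarrow> t < e \<Longrightarrow> 2 * \<phi> 0 \<le> \<phi> t + \<phi> (- t)"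
  shows "d \<ge> 0"
proof (rule ccontr)
  assume "\<not> d \<ge> 0"
  have d2m: "((\<lambda>t. \<phi>' (- t)) has_real_derivative d * (-1)) (at 0)"
    by (rule DERIV_chain2[of \<phi>']) (use d2 in \<open>auto intro!: derivative_eq_intros\<close>)
  have "((\<lambda>t. \<phi>' t - \<phi>' (- t)) has_real_derivative 2 * d) (at 0)"
    using DERIV_diff[OF d2 d2m] by simp
  then obtain \<delta> where \<delta>: "\<delta> > 0" "\<And>h. 0 < h \<Longrightarrow> h < \<delta> \<Longrightarrow> \<phi>' h - \<phi>' (- h) < 0"
    using DERIV_neg_dec_right[of "\<lambda>t. \<phi>' t - \<phi>' (- t)" "2 * d" 0] \<open>\<not> d \<ge> 0\<close> by auto
  define s where "s = min \<delta> e / 2"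
  have s: "0 < s" "s < \<delta>" "s < e" using \<delta>(1) e by (auto simp: s_def min_def)
  have d1m: "((\<lambda>t. \<phi> (- t)) has_real_derivative \<phi>' (- t) * (-1)) (at t)" for t
    by (rule DERIV_chain2[of \<phi>]) (use d1 in \<open>auto intro!: derivative_eq_intros\<close>)
  have "((\<lambda>t. \<phi> t + \<phi> (- t)) has_real_derivative \<phi>' t - \<phi>' (- t)) (at t)" for t
    using DERIV_add[OF d1 d1m] by simp
  from MVT2[OF s(1), of "\<lambda>t. \<phi> t + \<phi> (- t)", OF this]
  obtain \<xi> where \<xi>: "0 < \<xi>" "\<xi> < s" "\<phi> s + \<phi> (- s) - 2 * \<phi> 0 = s * (\<phi>' \<xi> - \<phi>' (- \<xi>))"
    by auto
  have "s * (\<phi>' \<xi> - \<phi>' (- \<xi>)) < 0"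
    using \<delta>(2)[of \<xi>] \<xi> s by (simp add: mult_pos_neg)
  then show False using \<xi>(3) ge[of s] s by simp
qed

text \<open>\<open>W = u\<^sub>x - \<i> u\<^sub>y\<close> and \<open>A = \<partial>W\<close>; the coefficient of \<open>cnj h\<close> is \<open>\<Delta>u / 2\<close> by Liouville's equation.\<close>

locale concave_liouville =
  fixes u :: "complex \<Rightarrow> real" and W A :: "complex \<Rightarrow> complex"
  assumes concave: "concave_on UNIV u"
    and du: "\<And>z. (u has_derivative (\<lambda>h. Re (W z * h))) (at z)"
    and dW: "\<And>z. (W has_derivative (\<lambda>h. A z * h - of_real (exp (2 * u z) / 2) * cnj h)) (at z)"
begin

lemma has_vector_derivative_line: "((\<lambda>t. z + of_real t * h) has_vector_derivative h) (at t)"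
proof -
  have "((\<lambda>t. z + t *\<^sub>R h) has_vector_derivative h) (at t)"
    by (auto intro!: derivative_eq_intros simp: has_vector_derivative_def)
  then show ?thesis by (simp add: scaleR_conv_of_real)
qed

lemma has_real_derivative_u_line:
  "((\<lambda>t. u (z + of_real t * h)) has_real_derivative Re (W (z + of_real t * h) * h)) (at t)"
  using vector_derivative_diff_chain_within[OF has_vector_derivative_line has_derivative_at_withinI[OF du]]
  by (simp add: has_real_derivative_iff_has_vector_derivative o_def)

lemma has_vector_derivative_W_line:
  "((\<lambda>t. W (z + of_real t * h)) has_vector_derivative
     A (z + of_real t * h) * h - of_real (exp (2 * u (z + of_real t * h)) / 2) * cnj h) (at t)"
  using vector_derivative_diff_chain_within[OF has_vector_derivative_line has_derivative_at_withinI[OF dW]]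
  by (simp add: o_def)

lemma has_real_derivative_W_line:
  "((\<lambda>t. Re (W (z + of_real t * h) * h)) has_real_derivative
     Re ((A z * h - of_real (exp (2 * u z) / 2) * cnj h) * h)) (at 0)"
proof -
  have "((\<lambda>t. W (z + of_real t * h) * h) has_vector_derivative
     (A z * h - of_real (exp (2 * u z) / 2) * cnj h) * h) (at 0)"
    using has_vector_derivative_mult_left[OF has_vector_derivative_W_line[of z h 0]] by simp
  from bounded_linear.has_vector_derivative[OF bounded_linear_Re this]
  show ?thesis
    unfolding has_real_derivative_iff_has_vector_derivative .
qed

lemma continuous_u: "continuous_on S u"
  using du has_derivative_continuous continuous_at_imp_continuous_on by blast

lemma u_le_tangent: "u w \<le> u z + Re (W z * (w - z))"
proof -
  have "convex_on UNIV (\<lambda>t. - u (z + of_real t * (w - z)))"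
  proof (rule convex_onI)
    fix t x y :: real assume t: "0 < t" "t < 1"
    have "z + of_real ((1 - t) *\<^sub>R x + t *\<^sub>R y) * (w - z)
      = (1 - t) *\<^sub>R (z + of_real x * (w - z)) + t *\<^sub>R (z + of_real y * (w - z))"
      by (simp add: scaleR_conv_of_real algebra_simps)
    then show "- u (z + of_real ((1 - t) *\<^sub>R x + t *\<^sub>R y) * (w - z))
       \<le> (1 - t) * - u (z + of_real x * (w - z)) + t * - u (z + of_real y * (w - z))"
      using concave t convex_onD[of UNIV "\<lambda>z. - u z" t] unfolding concave_on_def by simp
  qed auto
  from convex_on_imp_above_tangent[OF this, of 0 1]
  show ?thesis using DERIV_minus[OF has_real_derivative_u_line[of z "w - z" 0]] by fastforce
qed

text \<open>The linear terms of the two tangent bounds at the midpoint cancel.\<close>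

lemma u_midpoint: "u z + u w \<le> 2 * u ((z + w) / 2)"
proof -
  have "W ((z + w) / 2) * (z - (z + w) / 2) = - (W ((z + w) / 2) * (w - (z + w) / 2))"
    by (simp add: field_simps)
  then show ?thesis
    using u_le_tangent[of z "(z + w) / 2"] u_le_tangent[of w "(z + w) / 2"] by (simp del: times_divide_eq_right)
qed

text \<open>The second derivative of \<open>u\<close> in direction \<open>h\<close> is
  \<open>Re (A z * h^2) - exp (2 * u z) / 2 * |h|^2\<close>. It is at most \<open>0\<close> by
  concavity, and the best direction makes the first term real and nonnegative.\<close>

lemma norm_A_le: "cmod (A z) \<le> exp (2 * u z) / 2"
proof -
  \<comment> \<open>With \<open>h^2 = cnj (A z)\<close>, the product \<open>A z * h^2\<close> is
    \<open>|A z|^2\<close>, while \<open>|h|^2 = |A z|\<close>.\<close>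
  define h where "h = csqrt (cnj (A z))"
  have h2: "h * h = cnj (A z)" unfolding h_def by (metis power2_csqrt power2_eq_square)
  have nh: "h * cnj h = of_real (cmod (A z))"
    by (metis complex_mod_cnj complex_norm_square h2 norm_mult of_real_power power2_eq_square)
  have "- Re ((A z * h - of_real (exp (2 * u z) / 2) * cnj h) * h) \<ge> 0"
  proof (rule midpoint_convex_imp_second_derivative_nonneg[where e = 1])
    show "((\<lambda>t. - u (z + of_real t * h)) has_real_derivative - Re (W (z + of_real t * h) * h)) (at t)" for t
      by (intro DERIV_minus has_real_derivative_u_line)
    show "((\<lambda>t. - Re (W (z + of_real t * h) * h)) has_real_derivative
        - Re ((A z * h - of_real (exp (2 * u z) / 2) * cnj h) * h)) (at 0)"
      by (intro DERIV_minus has_real_derivative_W_line)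
    show "2 * - u (z + of_real 0 * h) \<le> - u (z + of_real t * h) + - u (z + of_real (- t) * h)" for t
      using u_midpoint[of "z + of_real t * h" "z - of_real t * h"] by simp
  qed simp
  moreover have "(A z * h - of_real (exp (2 * u z) / 2) * cnj h) * h
    = of_real (cmod (A z) * cmod (A z) - exp (2 * u z) / 2 * cmod (A z))"
  proof -
    have "(A z * h - of_real (exp (2 * u z) / 2) * cnj h) * h
      = A z * (h * h) - of_real (exp (2 * u z) / 2) * (h * cnj h)"
      by (simp add: algebra_simps)
    also have "A z * (h * h) = of_real (cmod (A z) * cmod (A z))"
      unfolding h2 by (metis complex_norm_square power2_eq_square)
    finally show ?thesis unfolding nh by simp
  qed
  ultimately have "cmod (A z) * cmod (A z) \<le> exp (2 * u z) / 2 * cmod (A z)"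
    by (simp only: Re_complex_of_real)
  then show ?thesis
    by (metis divide_nonneg_nonneg exp_ge_zero mult_right_le_imp_le norm_ge_zero
        order_le_less zero_le_numeral)
qed

lemma norm_dW_le: "cmod (A z * h - of_real (exp (2 * u z) / 2) * cnj h) \<le> exp (2 * u z) * cmod h"
proof -
  have "cmod (A z * h - of_real (exp (2 * u z) / 2) * cnj h)
    \<le> cmod (A z) * cmod h + exp (2 * u z) / 2 * cmod h"
    by (rule order_trans[OF norm_triangle_ineq4]) (simp add: norm_mult norm_divide)
  also have "\<dots> \<le> exp (2 * u z) / 2 * cmod h + exp (2 * u z) / 2 * cmod h"
    by (intro add_mono mult_right_mono norm_A_le) auto
  finally show ?thesis by (simp add: mult.commute)
qed

section \<open>Upper bound for \<open>u\<close> and growth of its gradient\<close>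

text \<open>Minimum principle for \<open>u + K |z - c|\<^sup>2\<close>, with \<open>K\<close> small enough that this function is
  strictly superharmonic on the disc.\<close>

lemma u_center_ge:
  assumes m: "\<And>z. z \<in> cball c 1 \<Longrightarrow> m \<le> u z"
  shows "m + exp (2 * m) / 8 \<le> u c"
proof -
  define K where "K = exp (2 * m) / 8"
  have K: "K > 0" by (simp add: K_def)
  define v where "v = (\<lambda>z. u z + K * (cmod (z - c))\<^sup>2)"
  have "continuous_on (cball c 1) v"
    unfolding v_def by (intro continuous_intros continuous_u)
  then obtain p where p: "p \<in> cball c 1" "\<And>z. z \<in> cball c 1 \<Longrightarrow> v p \<le> v z"
    using continuous_attains_inf[of "cball c 1" v] by auto
  have "p \<notin> ball c 1"
  proof
    assume pb: "p \<in> ball c 1"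
    \<comment> \<open>At an interior minimum, \<open>v\<close> has nonnegative second derivative
      along every line through \<open>p\<close>; \<open>2 * K\<close> is the share of the quadratic
      term.\<close>
    have ineq: "0 \<le> Re ((A p * h - of_real (exp (2 * u p) / 2) * cnj h) * h) + 2 * K"
      if h: "cmod h = 1" for h
    proof (rule midpoint_convex_imp_second_derivative_nonneg[where e = "1 - dist c p"])
      have sq: "(cmod (p + of_real t * h - c))\<^sup>2 = (cmod (p - c))\<^sup>2 + 2 * t * ((p - c) \<bullet> h) + t\<^sup>2" for t :: real
      proof -
        have "p + of_real t * h - c = (p - c) + t *\<^sub>R h" by (simp add: scaleR_conv_of_real)
        moreover have "h \<bullet> h = 1" using h by (simp add: dot_square_norm)
        ultimately show ?thesis
          by (simp only: power2_norm_eq_inner inner_add_left inner_add_right inner_scaleR_left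
              inner_scaleR_right inner_commute[of h "p - c"])
            (simp add: power2_eq_square distrib_left)
      qed
      show "((\<lambda>t. u (p + of_real t * h) + K * ((cmod (p - c))\<^sup>2 + 2 * t * ((p - c) \<bullet> h) + t\<^sup>2))
        has_real_derivative Re (W (p + of_real t * h) * h) + K * (2 * ((p - c) \<bullet> h) + 2 * t)) (at t)" for t
        by (rule derivative_eq_intros has_real_derivative_u_line refl)+ simp
      show "((\<lambda>t. Re (W (p + of_real t * h) * h) + K * (2 * ((p - c) \<bullet> h) + 2 * t)) has_real_derivative
         Re ((A p * h - of_real (exp (2 * u p) / 2) * cnj h) * h) + 2 * K) (at 0)"
        by (rule derivative_eq_intros has_real_derivative_W_line refl)+ simp
      show "0 < 1 - dist c p" using pb by simp
      fix t :: real assume t: "0 < t" "t < 1 - dist c p"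
      have "v p \<le> v (p + of_real s * h)" if "\<bar>s\<bar> = t" for s
      proof (rule p(2))
        have "dist c (p + of_real s * h) \<le> dist c p + dist p (p + of_real s * h)"
          by (rule dist_triangle)
        also have "dist p (p + of_real s * h) = t"
          using h that by (simp add: dist_norm norm_mult)
        finally show "p + of_real s * h \<in> cball c 1" using t by simp
      qed
      from this[of t] this[of "- t"] t
      show "2 * (u (p + of_real 0 * h) + K * ((cmod (p - c))\<^sup>2 + 2 * 0 * ((p - c) \<bullet> h) + 0\<^sup>2))
        \<le> u (p + of_real t * h) + K * ((cmod (p - c))\<^sup>2 + 2 * t * ((p - c) \<bullet> h) + t\<^sup>2)
        + (u (p + of_real (- t) * h) + K * ((cmod (p - c))\<^sup>2 + 2 * (- t) * ((p - c) \<bullet> h) + (- t)\<^sup>2))"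
        unfolding v_def sq by simp
    qed
    \<comment> \<open>Adding the two directions cancels \<open>A p\<close> and leaves the Laplacian
      of \<open>v\<close>. The choice of \<open>K\<close> gives
      \<open>4 * K = exp (2 * m) / 2\<close>, which is too small.\<close>
    have "exp (2 * u p) \<le> 4 * K" using ineq[of 1] ineq[of \<i>] by simp
    moreover have "exp (2 * m) \<le> exp (2 * u p)" using m p(1) by simp
    ultimately show False using K unfolding K_def by simp
  qed
  \<comment> \<open>The minimum lies on the circle, where the quadratic term equals
    \<open>K\<close>; at \<open>c\<close> that term vanishes, so \<open>u c\<close> gains
    \<open>K\<close>.\<close>
  then have "cmod (p - c) = 1" using p(1) by (simp add: dist_norm norm_minus_commute)
  then have "v p = u p + K" by (simp add: v_def)
  moreover have "v p \<le> v c" using p(2)[of c] by simp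
  ultimately show ?thesis using m[OF p(1)] by (simp add: v_def K_def)
qed

text \<open>On the unit disc about \<open>w / 2\<close> concavity bounds \<open>u\<close> below by \<open>(m + u w) / 2\<close>, so the minimum
  principle makes \<open>u (w / 2)\<close> larger than \<open>u w\<close> once \<open>u w\<close> is large. This is impossible if \<open>w\<close>
  maximises \<open>u\<close> on a disc about the origin.\<close>

lemma u_bounded_above: obtains M where "\<And>z. u z \<le> M"
proof -
  \<comment> \<open>Radius \<open>2\<close>: a point \<open>x\<close> of the unit disc about
    \<open>w / 2\<close> is the midpoint of \<open>w\<close> and \<open>2 * x - w\<close>, and the
    latter has modulus at most \<open>2\<close>.\<close>
  have "\<exists>p\<in>cball 0 2. \<forall>z\<in>cball 0 2. u p \<le> u z"
    by (rule continuous_attains_inf) (auto intro: continuous_u)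
  then obtain p where p: "\<And>z. z \<in> cball 0 2 \<Longrightarrow> u p \<le> u z" by blast
  define m where "m = u p"
  have bd: "u z \<le> 16 + 3 * \<bar>m\<bar>" for z
  proof -
    obtain w where w: "w \<in> cball 0 (cmod z)" "\<And>x. x \<in> cball 0 (cmod z) \<Longrightarrow> u x \<le> u w"
      using continuous_attains_sup[of "cball 0 (cmod z)" u, OF _ _ continuous_u] by auto
    have "(m + u w) / 2 \<le> u x" if "x \<in> cball (w / 2) 1" for x
    proof -
      have "cmod (2 * x - w) = 2 * cmod (x - w / 2)"
        using norm_mult[of 2 "x - w / 2"] by (simp add: right_diff_distrib)
      then have "2 * x - w \<in> cball 0 2"
        using that by (simp add: dist_norm norm_minus_commute)
      then show ?thesis
        using p[of "2 * x - w"] u_midpoint[of "2 * x - w" w] by (simp add: m_def)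
    qed
    then have "(m + u w) / 2 + exp (2 * ((m + u w) / 2)) / 8 \<le> u (w / 2)"
      by (rule u_center_ge)
    then have "(m + u w) / 2 + exp (m + u w) / 8 \<le> u (w / 2)"
      by (simp only: mult_2 field_sum_of_halves)
    also have "\<dots> \<le> u w"
      using w(1) norm_ge_zero[of z] by (intro w(2)) (simp add: norm_divide del: norm_ge_zero)
    finally have le: "(m + u w) / 2 + exp (m + u w) / 8 \<le> u w" .
    have "u w \<le> 16 + 3 * \<bar>m\<bar>"
    proof (rule ccontr)
      \<comment> \<open>Here \<open>s > 16\<close> turns the quadratic Taylor bound into
        \<open>exp s \<ge> 8 * s\<close>. The inequality \<open>le\<close> then yields
        \<open>s / 2 \<le> - m\<close>, against \<open>s > 2 * |m|\<close>.\<close>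
      define s where "s = m + u w"
      assume "\<not> ?thesis"
      then have s: "s > 16" "s > 2 * \<bar>m\<bar>" by (auto simp: s_def)
      have "1 + s + s\<^sup>2 / 2 \<le> exp s" using s by (intro exp_lower_Taylor_quadratic) simp
      moreover have "16 * s \<le> s\<^sup>2" using s by (simp add: power2_eq_square)
      ultimately have "exp s \<ge> 8 * s" using s by simp
      moreover have "s / 2 + exp s / 8 \<le> s - m" using le by (simp add: s_def)
      ultimately show False using s abs_ge_minus_self[of m] by linarith
    qed
    then show ?thesis using w(2)[of z] by simp
  qed
  then show ?thesis using that by blast
qed

lemma norm_W_le:
  assumes M: "\<And>z. u z \<le> M"
  shows "cmod (W z) \<le> cmod (W 0) + exp (2 * M) * cmod z"
proof -
  have "cmod (W z - W 0) \<le> exp (2 * M) * cmod (z - 0)"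
  proof (rule differentiable_bound[of UNIV])
    show "(W has_derivative (\<lambda>h. A x * h - of_real (exp (2 * u x) / 2) * cnj h)) (at x within UNIV)" for x
      using dW by simp
    show "onorm (\<lambda>h. A x * h - of_real (exp (2 * u x) / 2) * cnj h) \<le> exp (2 * M)" for x
    proof (rule onorm_bound)
      show "cmod (A x * h - of_real (exp (2 * u x) / 2) * cnj h) \<le> exp (2 * M) * cmod h" for h
        by (rule order_trans[OF norm_dW_le]) (use M[of x] in \<open>auto intro!: mult_right_mono\<close>)
    qed simp
  qed auto
  then show ?thesis using norm_triangle_ineq2[of "W z" "W 0"] by simp
qed

text \<open>If \<open>W\<close> vanished identically, so would its derivative, but the coefficient
  of \<open>cnj h\<close> there is never zero.\<close>

lemma exists_W_neq_0: "\<exists>z. W z \<noteq> 0"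
proof (rule ccontr)
  assume "\<not> ?thesis"
  then have "W = (\<lambda>z. 0)" by auto
  then have "(W has_derivative (\<lambda>h. 0)) (at 0)" by simp
  from has_derivative_unique[OF this dW]
  have "A 0 * h - of_real (exp (2 * u 0) / 2) * cnj h = 0" for h by metis
  from this[of 1] this[of \<i>] have "Re (A 0) = exp (2 * u 0) / 2" "Re (A 0) + exp (2 * u 0) / 2 = 0"
    by (simp_all add: complex_eq_iff)
  moreover have "exp (2 * u 0) > 0" by simp
  ultimately show False by linarith
qed

end

section \<open>Constancy of the Schwarzian derivative\<close>

text \<open>\<open>Q = A / 2 - W\<^sup>2 / 4\<close> grows at most quadratically, hence is a polynomial. Along the ray leaving a
  point \<open>z0\<close> against the gradient, \<open>u\<close> decays at least linearly and \<open>dW\<close> exponentially, so \<open>Q\<close> stays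
  bounded there while \<open>\<bar>W\<bar> \<ge> \<bar>W z0\<bar>\<close>; hence \<open>Q\<close> is a nonzero constant.\<close>

lemma (in concave_liouville) schwarzian_constant:
  assumes hol: "(\<lambda>z. A z / 2 - (W z)\<^sup>2 / 4) holomorphic_on UNIV"
  obtains q where "q \<noteq> 0" "\<And>z. A z / 2 - (W z)\<^sup>2 / 4 = q"
proof -
  define Q where "Q = (\<lambda>z. A z / 2 - (W z)\<^sup>2 / 4)"
  obtain M where M: "\<And>z. u z \<le> M" using u_bounded_above by blast
  have Q_le: "cmod (Q z) \<le> exp (2 * M) / 4 + (cmod (W z))\<^sup>2 / 4" for z
  proof -
    have "cmod (Q z) \<le> cmod (A z / 2) + cmod ((W z)\<^sup>2 / 4)"
      unfolding Q_def by (rule norm_triangle_ineq4)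
    also have "cmod (A z / 2) \<le> exp (2 * u z) / 4"
      using norm_A_le[of z] by (simp add: norm_divide)
    also have "\<dots> \<le> exp (2 * M) / 4" using M[of z] by simp
    finally show ?thesis by (simp add: norm_divide norm_power)
  qed
  \<comment> \<open>For \<open>|z| \<ge> 1\<close> constants are absorbed into multiples of
    \<open>|z|\<close> or \<open>|z|^2\<close>, so a single coefficient suffices.\<close>
  define B where "B = exp (2 * M) / 4 + (cmod (W 0) + exp (2 * M))\<^sup>2 / 4"
  have "cmod (Q z) \<le> B * cmod z ^ 2" if z: "1 \<le> cmod z" for z
  proof -
    have z2: "1 \<le> (cmod z)\<^sup>2" using z by (simp add: one_le_power)
    have "cmod (W z) \<le> (cmod (W 0) + exp (2 * M)) * cmod z"
      using norm_W_le[OF M, of z] mult_left_mono[OF z, of "cmod (W 0)"] by (simp add: distrib_right)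
    then have "(cmod (W z))\<^sup>2 \<le> (cmod (W 0) + exp (2 * M))\<^sup>2 * (cmod z)\<^sup>2"
      by (metis norm_ge_zero power_mono power_mult_distrib)
    moreover have "exp (2 * M) / 4 \<le> exp (2 * M) / 4 * (cmod z)\<^sup>2"
      using mult_left_mono[OF z2, of "exp (2 * M) / 4"] by simp
    ultimately show ?thesis
      using Q_le[of z] unfolding B_def distrib_right times_divide_eq_left by linarith
  qed
  moreover have "Q holomorphic_on UNIV" unfolding Q_def by (rule hol)
  ultimately have "Q z = (\<Sum>k\<le>2. (deriv ^^ k) Q 0 / fact k * z ^ k)" for z
    using Liouville_polynomial[of Q 1 B 2 z] by blast
  then obtain c where poly: "\<And>z. Q z = (\<Sum>k\<le>2. c k * z ^ k)" by metis
  obtain z0 where z0: "W z0 \<noteq> 0" using exists_W_neq_0 by blast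
  define k where "k = cmod (W z0)"
  have k: "k > 0" using z0 by (simp add: k_def)
  \<comment> \<open>The gradient vector of \<open>u\<close> is \<open>cnj W\<close>, so
    \<open>e\<close> is the unit direction of steepest descent at \<open>z0\<close>, with slope
    \<open>- k\<close>.\<close>
  define e where "e = - cnj (W z0) / of_real k"
  have e: "cmod e = 1" using k by (simp add: e_def k_def norm_divide)
  have We: "W z0 * e = - of_real k"
  proof -
    have "W z0 * e = - (W z0 * cnj (W z0)) / of_real k" by (simp add: e_def)
    also have "W z0 * cnj (W z0) = of_real k * of_real k"
      by (simp add: complex_norm_square[symmetric] k_def power2_eq_square)
    finally show ?thesis using k by simp
  qed
  define \<zeta> where "\<zeta> = (\<lambda>t::real. z0 + of_real t * e)"
  have u_ray: "u (\<zeta> t) \<le> u z0 - k * t" for t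
  proof -
    have "W z0 * (\<zeta> t - z0) = of_real t * (W z0 * e)" by (simp add: \<zeta>_def)
    also have "\<dots> = of_real (- (k * t))" unfolding We by simp
    finally have "W z0 * (\<zeta> t - z0) = of_real (- (k * t))" .
    then show ?thesis using u_le_tangent[of "\<zeta> t" z0] by (simp only: Re_complex_of_real)
  qed
  \<comment> \<open>The tangent at \<open>\<zeta> t\<close>, evaluated back at \<open>z0\<close>, is
    compared with \<open>u_ray\<close>: the slope along the ray stays at most
    \<open>- k\<close>.\<close>
  have W_lower: "k \<le> cmod (W (\<zeta> t))" if t: "t > 0" for t
  proof -
    have "W (\<zeta> t) * (z0 - \<zeta> t) = of_real (- t) * (W (\<zeta> t) * e)" by (simp add: \<zeta>_def)
    then have "Re (W (\<zeta> t) * (z0 - \<zeta> t)) = - t * Re (W (\<zeta> t) * e)"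
      by (simp only: Re_complex_of_real Im_complex_of_real times_complex.sel(1)[of "of_real (-t)"])
    then have "t * k \<le> t * - Re (W (\<zeta> t) * e)"
      using u_le_tangent[of z0 "\<zeta> t"] u_ray[of t]
      unfolding mult_minus_left mult_minus_right mult.commute[of t k] by linarith
    then have "k \<le> - Re (W (\<zeta> t) * e)" using t by simp
    also have "\<dots> \<le> cmod (W (\<zeta> t) * e)" by (metis abs_Re_le_cmod abs_le_D2)
    finally show ?thesis using e by (simp add: norm_mult)
  qed
  have W_upper: "cmod (W (\<zeta> t)) \<le> k + exp (2 * u z0) / (2 * k)" if t: "t > 0" for t
  proof -
    \<comment> \<open>A primitive of the exponential bound for the derivative of \<open>W\<close>
      along the ray; its total increase is at most \<open>exp (2 * u z0) / (2 * k)\<close>.\<close>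
    define \<phi> where "\<phi> = (\<lambda>s. - exp (2 * u z0 - 2 * k * s) / (2 * k))"
    have dphi: "(\<phi> has_vector_derivative exp (2 * u z0 - 2 * k * s)) (at s)" for s
      unfolding \<phi>_def has_real_derivative_iff_has_vector_derivative[symmetric]
      using k by (auto intro!: derivative_eq_intros)
    have "cmod (W (\<zeta> t) - W (\<zeta> 0)) \<le> \<phi> t - \<phi> 0"
    proof (rule differentiable_bound_general[OF t])
      show "((\<lambda>s. W (\<zeta> s)) has_vector_derivative
          A (\<zeta> s) * e - of_real (exp (2 * u (\<zeta> s)) / 2) * cnj e) (at s)" for s
        unfolding \<zeta>_def by (rule has_vector_derivative_W_line)
      then show "continuous_on {0..t} (\<lambda>s. W (\<zeta> s))"
        using has_vector_derivative_continuous continuous_at_imp_continuous_on by blast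
      show "(\<phi> has_vector_derivative exp (2 * u z0 - 2 * k * s)) (at s)" for s by (rule dphi)
      then show "continuous_on {0..t} \<phi>"
        using has_vector_derivative_continuous continuous_at_imp_continuous_on by blast
      show "cmod (A (\<zeta> s) * e - of_real (exp (2 * u (\<zeta> s)) / 2) * cnj e) \<le> exp (2 * u z0 - 2 * k * s)" for s
        by (rule order_trans[OF norm_dW_le]) (use u_ray[of s] e in simp)
    qed
    also have "\<dots> \<le> exp (2 * u z0) / (2 * k)" using k by (simp add: \<phi>_def)
    finally have "cmod (W (\<zeta> t) - W z0) \<le> exp (2 * u z0) / (2 * k)" by (simp add: \<zeta>_def)
    then show ?thesis using norm_triangle_ineq2[of "W (\<zeta> t)" "W z0"] by (simp add: k_def)
  qed
  define C where "C = exp (2 * M) / 4 + (k + exp (2 * u z0) / (2 * k))\<^sup>2 / 4"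
  have Q_ray: "cmod (Q (\<zeta> t)) \<le> C" if "t > 0" for t
    using Q_le[of "\<zeta> t"] power_mono[OF W_upper[OF that] norm_ge_zero, of 2] unfolding C_def by linarith
  have c0: "c j = 0" if j: "1 \<le> j" "j \<le> 2" for j
  proof (rule ccontr)
    assume "c j \<noteq> 0"
    with j have "\<exists>k. k \<noteq> 0 \<and> k \<le> 2 \<and> c k \<noteq> 0" by (intro exI[of _ j]) auto
    from polyfun_extremal[OF this, of "C + 1"]
    obtain b where b: "\<And>z. b \<le> cmod z \<Longrightarrow> C + 1 \<le> cmod (Q z)"
      unfolding poly[symmetric] eventually_at_infinity by blast
    \<comment> \<open>Far enough along the ray that \<open>cmod (\<zeta> t) \<ge> b\<close>, where
      the nonconstant polynomial exceeds the bound \<open>C\<close>.\<close>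
    define t where "t = cmod z0 + \<bar>b\<bar> + 1"
    have t: "t > 0" unfolding t_def by (simp add: add_nonneg_pos)
    have "t \<le> cmod (\<zeta> t) + cmod z0"
      using norm_triangle_ineq4[of "\<zeta> t" z0] t e by (simp add: \<zeta>_def norm_mult)
    then have "b \<le> cmod (\<zeta> t)" unfolding t_def by linarith
    from b[OF this] Q_ray[OF t] show False by simp
  qed
  have Qc: "Q z = c 0" for z
    unfolding poly[of z] using c0 by (simp add: numeral_2_eq_2)
  \<comment> \<open>If \<open>Q\<close> were zero, \<open>|W|^2 = 2 * |A|\<close> would be at most
    \<open>exp (2 * u)\<close>, which decays along the ray, whereas \<open>|W| \<ge> k\<close>
    there.\<close>
  have "c 0 \<noteq> 0"
  proof
    assume z: "c 0 = 0"
    \<comment> \<open>Chosen so that \<open>u z0 - k * t \<le> ln k - k < ln k\<close>.\<close>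
    define t where "t = \<bar>u z0 - ln k\<bar> / k + 1"
    have t: "t > 0" using k unfolding t_def by (simp add: add_nonneg_pos)
    have "(W (\<zeta> t))\<^sup>2 = 2 * A (\<zeta> t)" using Qc[of "\<zeta> t"] z by (simp add: Q_def)
    then have "(cmod (W (\<zeta> t)))\<^sup>2 = 2 * cmod (A (\<zeta> t))"
      by (metis norm_mult norm_numeral norm_power)
    moreover have "k\<^sup>2 \<le> (cmod (W (\<zeta> t)))\<^sup>2" using W_lower[OF t] k by (intro power_mono) auto
    ultimately have "k\<^sup>2 \<le> exp (2 * u (\<zeta> t))" using norm_A_le[of "\<zeta> t"] by linarith
    moreover have "k\<^sup>2 = exp (2 * ln k)" using k by (simp add: exp_double)
    ultimately have "ln k \<le> u z0 - k * t" using u_ray[of t] by simp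
    moreover have "k * t = \<bar>u z0 - ln k\<bar> + k" using k by (simp add: t_def field_simps)
    ultimately show False using k by linarith
  qed
  then show ?thesis using that Qc unfolding Q_def by blast
qed

section \<open>Functions with constant Schwarzian derivative\<close>

text \<open>Both \<open>s = c\<close> and \<open>s = - c\<close> give a first integral
  \<open>(y' + s * y) * exp (- (s * z))\<close>; eliminating \<open>y'\<close> from the two recovers
  \<open>y\<close>.\<close>

lemma second_order_linear_ode_solution:
  fixes y y' :: "complex \<Rightarrow> complex"
  assumes S: "convex S" and c: "c \<noteq> 0"
    and d1: "\<And>z. z \<in> S \<Longrightarrow> (y has_field_derivative y' z) (at z)"
    and d2: "\<And>z. z \<in> S \<Longrightarrow> (y' has_field_derivative c\<^sup>2 * y z) (at z)"
  shows "\<exists>a b. \<forall>z\<in>S. y z = a * exp (c * z) + b * exp (- (c * z))"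
proof -
  have "\<exists>K. \<forall>z\<in>S. (y' z + s * y z) * exp (- (s * z)) = K" if s: "s\<^sup>2 = c\<^sup>2" for s
  proof (rule has_field_derivative_zero_constant[OF S])
    fix z assume z: "z \<in> S"
    have "((\<lambda>z. (y' z + s * y z) * exp (- (s * z))) has_field_derivative
      (c\<^sup>2 * y z + s * y' z) * exp (- (s * z)) - s * exp (- (s * z)) * (y' z + s * y z)) (at z)"
      by (rule derivative_eq_intros d1[OF z] d2[OF z] refl)+ (simp add: algebra_simps)
    also have "(c\<^sup>2 * y z + s * y' z) * exp (- (s * z)) - s * exp (- (s * z)) * (y' z + s * y z) = 0"
      unfolding s[symmetric] by (simp add: algebra_simps power2_eq_square)
    finally show "((\<lambda>z. (y' z + s * y z) * exp (- (s * z))) has_field_derivative 0) (at z within S)"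
      by (rule has_field_derivative_at_within)
  qed
  from this[of c] this[of "- c"] obtain K1 K2 where
    K: "\<And>z. z \<in> S \<Longrightarrow> (y' z + c * y z) * exp (- (c * z)) = K1"
       "\<And>z. z \<in> S \<Longrightarrow> (y' z - c * y z) * exp (c * z) = K2" by auto
  have "y z = K1 / (2 * c) * exp (c * z) + - K2 / (2 * c) * exp (- (c * z))" if z: "z \<in> S" for z
  proof -
    have ee: "exp (- (c * z)) * exp (c * z) = 1" by (simp add: exp_minus)
    have "K1 * exp (c * z) = y' z + c * y z"
      unfolding K(1)[OF z, symmetric] mult.assoc ee by simp
    moreover have "K2 * exp (- (c * z)) = y' z - c * y z"
      unfolding K(2)[OF z, symmetric] mult.assoc mult.commute[of "exp (c * z)"] ee by simp
    ultimately have "2 * c * y z = K1 * exp (c * z) - K2 * exp (- (c * z))" by simp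
    then have "y z = (K1 * exp (c * z) - K2 * exp (- (c * z))) / (2 * c)"
      using c by (metis mult_eq_0_iff nonzero_mult_div_cancel_left zero_neq_numeral)
    then show ?thesis by (simp add: diff_divide_distrib)
  qed
  then show ?thesis by blast
qed

text \<open>\<open>h = 1 / sqrt f'\<close> and \<open>f h\<close> are both solutions of \<open>y'' + q y = 0\<close>.\<close>

lemma half_schwarzian_constant_imp_exp_quotient:
  assumes hol: "f holomorphic_on ball z0 r" and r: "r > 0"
    and nz: "\<And>z. z \<in> ball z0 r \<Longrightarrow> deriv f z \<noteq> 0"
    and q: "q \<noteq> 0" "\<And>z. z \<in> ball z0 r \<Longrightarrow> half_schwarzian f z = q"
  obtains a \<alpha> \<beta> \<gamma> \<delta> where "a \<noteq> 0" "\<alpha> * \<delta> - \<beta> * \<gamma> \<noteq> 0"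
    "\<And>z. z \<in> ball z0 r \<Longrightarrow> f z * (\<gamma> * exp (a * z) + \<delta>) = \<alpha> * exp (a * z) + \<beta>"
proof -
  let ?S = "ball z0 r"
  \<comment> \<open>A nonvanishing derivative on a disc has a holomorphic logarithm, so
    \<open>h = exp (- g / 2)\<close> is a branch of \<open>1 / sqrt f'\<close>.\<close>
  obtain g where g: "g holomorphic_on ?S" "\<And>z. z \<in> ?S \<Longrightarrow> exp (g z) = deriv f z"
    using holomorphic_logarithm_exists[of ?S "deriv f" z0] hol nz r holomorphic_deriv by auto
  define P where "P = pre_schwarzian f"
  define h where "h = (\<lambda>z. exp (- g z / 2))"
  define c where "c = csqrt (- q)"
  have c: "c\<^sup>2 = - q" "c \<noteq> 0" using q(1) by (auto simp: c_def)
  have df: "(f has_field_derivative deriv f z) (at z)" if "z \<in> ?S" for z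
    using holomorphic_derivI[OF hol open_ball that] .
  have ddf: "(deriv f has_field_derivative P z * deriv f z) (at z)" if "z \<in> ?S" for z
    using holomorphic_derivI[OF holomorphic_deriv[OF hol open_ball] open_ball that] nz[OF that]
    by (simp add: P_def pre_schwarzian_def)
  have dg: "(g has_field_derivative P z) (at z)" if z: "z \<in> ?S" for z
  proof -
    have d: "(g has_field_derivative deriv g z) (at z)"
      using holomorphic_derivI[OF g(1) open_ball z] .
    have "((\<lambda>z. exp (g z)) has_field_derivative exp (g z) * deriv g z) (at z)"
      using d by (auto intro!: derivative_eq_intros)
    then have "(deriv f has_field_derivative exp (g z) * deriv g z) (at z)"
      by (rule has_field_derivative_transform_within_open[OF _ open_ball z]) (use g in auto)
    from DERIV_unique[OF this ddf[OF z]] have "deriv g z = P z"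
      using g(2)[OF z] nz[OF z] by simp
    then show ?thesis using d by simp
  qed
  have dP: "(P has_field_derivative 2 * q + (P z)\<^sup>2 / 2) (at z)" if z: "z \<in> ?S" for z
  proof -
    have "(P has_field_derivative deriv P z) (at z)"
      unfolding P_def using holomorphic_derivI[OF holomorphic_pre_schwarzian[OF hol open_ball nz] open_ball z] .
    moreover have "deriv P z = 2 * q + (P z)\<^sup>2 / 2"
      using q(2)[OF z] unfolding half_schwarzian_def P_def[symmetric] by (simp add: field_simps)
    ultimately show ?thesis by simp
  qed
  have dh: "(h has_field_derivative - P z / 2 * h z) (at z)" if z: "z \<in> ?S" for z
    unfolding h_def using dg[OF z] by (auto intro!: derivative_eq_intros)
  have ddh: "((\<lambda>z. - P z / 2 * h z) has_field_derivative c\<^sup>2 * h z) (at z)" if z: "z \<in> ?S" for z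
    unfolding c
    using dP[OF z] dh[OF z]
    by (auto intro!: derivative_eq_intros simp: field_simps power2_eq_square)
  have dk: "((\<lambda>z. f z * h z) has_field_derivative deriv f z * h z - f z * (P z / 2 * h z)) (at z)"
    if z: "z \<in> ?S" for z
    using df[OF z] dh[OF z] by (auto intro!: derivative_eq_intros simp: field_simps)
  have ddk: "((\<lambda>z. deriv f z * h z - f z * (P z / 2 * h z)) has_field_derivative c\<^sup>2 * (f z * h z)) (at z)"
    if z: "z \<in> ?S" for z
    unfolding c
    using df[OF z] ddf[OF z] dP[OF z] dh[OF z]
    by (auto intro!: derivative_eq_intros simp: field_simps power2_eq_square)
  obtain \<gamma> \<delta> where h: "\<And>z. z \<in> ?S \<Longrightarrow> h z = \<gamma> * exp (c * z) + \<delta> * exp (- (c * z))"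
    using second_order_linear_ode_solution[OF convex_ball c(2) dh ddh] by blast
  obtain \<alpha> \<beta> where k: "\<And>z. z \<in> ?S \<Longrightarrow> f z * h z = \<alpha> * exp (c * z) + \<beta> * exp (- (c * z))"
    using second_order_linear_ode_solution[OF convex_ball c(2) dk ddk] by blast
  \<comment> \<open>The factor \<open>exp (c * z)\<close> makes both solutions affine in
    \<open>exp (2 * c * z)\<close>, so the exponent of the result is
    \<open>a = 2 * c\<close>.\<close>
  have mult: "(x * exp (c * z) + y * exp (- (c * z))) * exp (c * z) = x * exp (2 * c * z) + y" for x y z
    by (simp add: distrib_right mult.assoc flip: exp_add)
  have hN: "h z * exp (c * z) = \<gamma> * exp (2 * c * z) + \<delta>" if z: "z \<in> ?S" for z
    unfolding h[OF z] mult ..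
  have eq: "f z * (\<gamma> * exp (2 * c * z) + \<delta>) = \<alpha> * exp (2 * c * z) + \<beta>" if z: "z \<in> ?S" for z
    unfolding hN[OF z, symmetric] mult.assoc[symmetric] k[OF z] mult ..
  \<comment> \<open>With zero determinant, numerator and denominator are proportional and
    \<open>f\<close> is constant, against \<open>deriv f z0\<close> being nonzero. The denominator
    has no zeros on the disc because \<open>h\<close> is an exponential.\<close>
  have "\<alpha> * \<delta> - \<beta> * \<gamma> \<noteq> 0"
  proof
    assume det: "\<alpha> * \<delta> - \<beta> * \<gamma> = 0"
    have Nnz: "\<gamma> * exp (2 * c * z) + \<delta> \<noteq> 0" if "z \<in> ?S" for z
      unfolding hN[OF that, symmetric] h_def by simp
    have "\<exists>w. \<forall>z\<in>?S. f z = w"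
    proof (cases "\<gamma> = 0")
      case True
      then have "\<delta> \<noteq> 0" using Nnz[of z0] r by auto
      moreover have "\<alpha> = 0" using det True \<open>\<delta> \<noteq> 0\<close> by simp
      ultimately show ?thesis using eq True by (metis add_0 mult_zero_left nonzero_mult_div_cancel_right)
    next
      case False
      have "f z = \<alpha> / \<gamma>" if z: "z \<in> ?S" for z
      proof -
        have "(f z * \<gamma>) * (\<gamma> * exp (2 * c * z) + \<delta>) = \<gamma> * (\<alpha> * exp (2 * c * z) + \<beta>)"
          using eq[OF z] by (simp add: mult.assoc mult.left_commute)
        also have "\<dots> = \<alpha> * (\<gamma> * exp (2 * c * z) + \<delta>)" using det by (simp add: algebra_simps)
        finally have "f z * \<gamma> = \<alpha>" using mult_right_cancel[OF Nnz[OF z]] by blast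
        then show ?thesis using False by (simp add: field_simps)
      qed
      then show ?thesis by blast
    qed
    then obtain w where w: "\<And>z. z \<in> ?S \<Longrightarrow> f z = w" by blast
    have "((\<lambda>z. w) has_field_derivative 0) (at z0)" by simp
    then have "(f has_field_derivative 0) (at z0)"
      by (rule has_field_derivative_transform_within_open[OF _ open_ball, of _ _ _ z0 r]) (use w r in auto)
    then have "deriv f z0 = 0" by (rule DERIV_imp_deriv)
    then show False using nz[of z0] r by simp
  qed
  then show ?thesis using that[of "2 * c" \<alpha> \<delta> \<beta> \<gamma>] eq c(2) by simp
qed

section \<open>Continuation to the whole plane\<close>

text \<open>Without the division, both sides are holomorphic off the poles. The poles are sparse, so
  their complement is connected and the identity theorem applies. It remains to match poles of
  \<open>f\<close> with zeros of the denominator.\<close>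

lemma nicely_meromorphic_exp_quotient:
  assumes nm: "f nicely_meromorphic_on UNIV" and S: "open S" "S \<noteq> {}" "\<And>z. z \<in> S \<Longrightarrow> \<not> is_pole f z"
    and det: "\<alpha> * \<delta> - \<beta> * \<gamma> \<noteq> 0"
    and eq: "\<And>z. z \<in> S \<Longrightarrow> f z * (\<gamma> * exp (a * z) + \<delta>) = \<alpha> * exp (a * z) + \<beta>"
  shows "sphere_map f z = moebius \<alpha> \<beta> \<gamma> \<delta> (Some (exp (a * z)))"
proof -
  obtain pts where pts: "pts sparse_in UNIV" "f analytic_on UNIV - pts" "\<And>z. z \<in> pts \<Longrightarrow> is_pole f z"
    using nicely_meromorphic_onE[OF nm] by metis
  have op: "open (UNIV - pts)" by (rule open_diff_sparse_pts[OF open_UNIV pts(1)])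
  have con: "connected (UNIV - pts)"
    by (rule sparse_imp_connected[OF _ _ _ pts(1)]) auto
  have hol: "f holomorphic_on UNIV - pts" using pts(2) by (rule analytic_imp_holomorphic)
  have pole: "is_pole f z \<longleftrightarrow> z \<in> pts" for z
    using pts(3) not_is_pole_holomorphic[OF op _ hol] by blast
  have eq': "f z * (\<gamma> * exp (a * z) + \<delta>) = \<alpha> * exp (a * z) + \<beta>" if z: "z \<in> UNIV - pts" for z
    by (rule analytic_continuation_open[OF S(1) op S(2) con, where z = z])
      (use S(3) eq pole z in \<open>auto intro!: holomorphic_intros hol\<close>)
  show ?thesis
  proof (cases "is_pole f z")
    case True
    \<comment> \<open>At a pole \<open>1 / f\<close> tends to \<open>0\<close>; dividing the
      identity by \<open>f\<close> makes the denominator tend to \<open>0\<close>.\<close>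
    have "((\<lambda>w. (\<alpha> * exp (a * w) + \<beta>) * inverse (f w)) \<longlongrightarrow> (\<alpha> * exp (a * z) + \<beta>) * 0) (at z)"
      by (intro tendsto_intros tendsto_mult) (use True in \<open>auto simp: is_pole_def intro: tendsto_inverse_0 filterlim_compose\<close>)
    then have "((\<lambda>w. \<gamma> * exp (a * w) + \<delta>) \<longlongrightarrow> (\<alpha> * exp (a * z) + \<beta>) * 0) (at z)"
    proof (rule Lim_transform_eventually)
      have "eventually (\<lambda>w. w \<notin> pts) (at z)"
        using pts(1) by (simp add: sparse_in_eventually_iff)
      moreover have "eventually (\<lambda>w. f w \<noteq> 0) (at z)"
        using True non_zero_neighbour_pole by blast
      ultimately show "eventually (\<lambda>w. (\<alpha> * exp (a * w) + \<beta>) * inverse (f w) = \<gamma> * exp (a * w) + \<delta>) (at z)"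
        by eventually_elim (use eq' in \<open>auto simp: field_simps\<close>)
    qed
    moreover have "((\<lambda>w. \<gamma> * exp (a * w) + \<delta>) \<longlongrightarrow> \<gamma> * exp (a * z) + \<delta>) (at z)"
      by (intro tendsto_intros)
    ultimately have "\<gamma> * exp (a * z) + \<delta> = 0"
      using tendsto_unique[of "at z"] by fastforce
    then show ?thesis using True by (simp add: sphere_map_def moebius_def)
  next
    case False
    then have e: "f z * (\<gamma> * exp (a * z) + \<delta>) = \<alpha> * exp (a * z) + \<beta>"
      using eq'[of z] pole by simp
    \<comment> \<open>Where \<open>f\<close> is finite, a zero of the denominator would also be one
      of the numerator, forcing the determinant to vanish.\<close>
    have "\<gamma> * exp (a * z) + \<delta> \<noteq> 0"
    proof
      assume N: "\<gamma> * exp (a * z) + \<delta> = 0"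
      then have "\<delta> = - (\<gamma> * exp (a * z))" "\<beta> = - (\<alpha> * exp (a * z))"
        using e by (auto simp: eq_neg_iff_add_eq_0 add.commute)
      then show False using det by simp
    qed
    then show ?thesis using False e by (simp add: sphere_map_def moebius_def field_simps)
  qed
qed

theorem theorem1p1:
  fixes u :: "complex \<Rightarrow> real" and f :: "complex \<Rightarrow> complex"
  assumes "liouville_solution u"
    and "developing_map f u"
    and "concave_on UNIV u"
  shows "\<exists>L a b. linear_fractional L \<and> a \<noteq> 0 \<and>
           (\<forall>z. sphere_map f z = L (Some (exp (a * z + b))))"
proof -
  note dev = assms(2)
  obtain W A where
    du: "\<And>z. (u has_derivative (\<lambda>h. Re (W z * h))) (at z)"
    and dW: "\<And>z. (W has_derivative (\<lambda>h. A z * h - of_real (exp (2 * u z) / 2) * cnj h)) (at z)"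
    and hol: "(\<lambda>z. A z / 2 - (W z)\<^sup>2 / 4) holomorphic_on UNIV"
    and hs: "\<And>z. \<not> is_pole f z \<Longrightarrow> A z / 2 - (W z)\<^sup>2 / 4 = half_schwarzian f z"
    using developing_map_derivatives[OF dev] by blast
  interpret concave_liouville u W A
    by standard (fact assms(3), fact du, fact dW)
  obtain q where q: "q \<noteq> 0" "\<And>z. A z / 2 - (W z)\<^sup>2 / 4 = q"
    using schwarzian_constant[OF hol] by blast
  have nm: "f nicely_meromorphic_on UNIV"
    using dev by (simp add: developing_map_def meromorphic_local_homeo_def)
  obtain pts where pts: "pts sparse_in UNIV" "f analytic_on UNIV - pts"
    using nicely_meromorphic_onE[OF nm] by metis
  \<comment> \<open>The exceptional set is countable, so there is a point at which \<open>f\<close>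
    is analytic to start from.\<close>
  have "countable pts" using sparse_imp_countable[OF open_UNIV pts(1)] by simp
  then have "pts \<noteq> UNIV" using uncountable_UNIV_complex by blast
  then obtain z0 where "z0 \<in> UNIV - pts" by auto
  then have "\<not> is_pole f z0"
    using pts(2) by (meson analytic_at_imp_no_pole analytic_on_analytic_at)
  then obtain r where r: "r > 0" "f holomorphic_on ball z0 r"
    "\<And>w. w \<in> ball z0 r \<Longrightarrow> \<not> is_pole f w" "\<And>w. w \<in> ball z0 r \<Longrightarrow> deriv f w \<noteq> 0"
    using developing_map_local_nonpole[OF dev] by metis
  have "half_schwarzian f w = q" if "w \<in> ball z0 r" for w
    using hs[OF r(3)[OF that]] q(2) by simp
  then obtain a \<alpha> \<beta> \<gamma> \<delta> where a: "a \<noteq> 0" "\<alpha> * \<delta> - \<beta> * \<gamma> \<noteq> 0"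
    "\<And>z. z \<in> ball z0 r \<Longrightarrow> f z * (\<gamma> * exp (a * z) + \<delta>) = \<alpha> * exp (a * z) + \<beta>"
    using half_schwarzian_constant_imp_exp_quotient[OF r(2,1,4) q(1)] by metis
  \<comment> \<open>The witness for \<open>b\<close> is \<open>0\<close>, since a factor
    \<open>exp b\<close> can be absorbed into the coefficients of the transformation.\<close>
  have "sphere_map f z = moebius \<alpha> \<beta> \<gamma> \<delta> (Some (exp (a * z + 0)))" for z
    using nicely_meromorphic_exp_quotient[OF nm open_ball[of z0 r] _ r(3) a(2,3)] r(1) by simp
  moreover have "linear_fractional (moebius \<alpha> \<beta> \<gamma> \<delta>)"
    using a(2) unfolding linear_fractional_def by blast
  ultimately show ?thesis using a(1) by blast
qed

end
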